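(* There exists an absolute constant $C>0$ such that the following holds. Let $f\not\equiv 0$ be holomorphic in $\mathbb D(0,5)$. Let $d\ge 1$ be an integer, and let $H_0\ge 1$ and $H_1\ge d$ be real numbers. Assume that $$\sup_{\mathbb D(0,4)}|f|\le e^{H_0}\sup_{\mathbb D(0,1)}|f|$$ and that $$\sup_{\mathbb D(x,4)}|f|\le e^{H_1}r^{-d}\sup_{\mathbb D(x,r)}|f|\qquad\text{for all } x\in I_0 \text{ and all } 0<r\le 1.$$ Then: (i) The zero set of $f$ on $I_0$ is finite, and (after redefining $\log|f|$ on this finite set) $\log|f|$ is integrable on $I_0$; thus $G_E(f)$ is well defined for every measurable $E\subset I_0$ with $|E|>0$. (ii) For every measurable $E\subset I_0$ with $|E|=\alpha>0$, $$\sup_{I_0}|f|\le e^{C(H_0+H_1)}\left(\frac{C}{\alpha}\right)^d G_E(f),$$ and consequently $$\sup_{I_0}|f|\le e^{C(H_0+H_1)}\left(\frac{C}{\alpha}\right)^d \operatorname*{ess\,sup}_E|f|.$$ (iii) For every $0<h\le 1$ there exists a set $\Omega_h\subset I_0$, representable as a union of at most $\lceil C H_0\rceil$ intervals, such that $|\Omega_h|\le Ch$ and $$|f(x)|\ge e^{-C(H_0+H_1)}h^d\sup_{I_0}|f|\qquad\text{for all } x\in I_0\setminus\Omega_h.$$ (iv) For every $0<\varepsilon\le 1$, $$\left|\left\{x\in I_0: |f(x)|\le \varepsilon\sup_{I_0}|f|\right\}\right|\le C\exp\left(C\frac{H_0+H_1}{d}\right)\varepsilon^{1/d}.$$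
   Context: $I_0=[-1/2,1/2]\subset\mathbb R\subset\mathbb C$, and $\mathbb D(a,r)=\{z\in\mathbb C:|z-a|<r\}$. $|\cdot|$ applied to a subset of $\mathbb R$ denotes Lebesgue measure. For a measurable set $E\subset\mathbb R$ with $|E|>0$ and a function $g$ with $\log|g|\in L^1(E)$ (where $\log|g|$ may be redefined arbitrarily on a finite set, such as the zeros of $g$), the geometric mean is $$G_E(g)=\exp\left(\frac1{|E|}\int_E\log|g(t)|\,dt\right).$$ "Absolute constant" means independent of all other data in the statement. *)

theory Defs
  imports "HOL-Complex_Analysis.Complex_Analysis" "HOL-Probability.Essential_Supremum"
begin

definition I0 :: "real set" where
  "I0 = {-1/2..1/2}"

text \<open>At a zero of \<open>g\<close> the library has \<open>ln 0 = 0\<close>, which is one admissible redefinition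
  of \<open>log |g|\<close> on the (finite) zero set; \<open>geom_mean_redefine\<close> below shows that
  every other one gives the same value.\<close>

definition geom_mean :: "real set \<Rightarrow> (real \<Rightarrow> 'a::real_normed_vector) \<Rightarrow> real" where
  "geom_mean E g =
     exp (1 / measure lebesgue E * (LINT t|lebesgue_on E. ln (norm (g t))))"

lemma ln_norm_redefine_AE:
  fixes L :: "real \<Rightarrow> real"
  assumes E: "E \<in> sets lebesgue"
    and fin: "finite {t \<in> E. L t \<noteq> ln (norm (g t))}"
  shows "AE t in lebesgue_on E. ln (norm (g t)) = L t"
proof -
  have "negligible {t \<in> E. L t \<noteq> ln (norm (g t))}"
    using fin by (rule negligible_finite)
  then have "AE t in lebesgue. t \<in> E \<longrightarrow> ln (norm (g t)) = L t"
    unfolding negligible_iff_null_sets by (rule AE_I') auto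
  then show ?thesis
    using E by (simp add: AE_restrict_space_iff)
qed

lemma ln_norm_redefine_integrable_iff:
  fixes L :: "real \<Rightarrow> real"
  assumes "E \<in> sets lebesgue"
    and "L \<in> borel_measurable (lebesgue_on E)"
    and "(\<lambda>t. ln (norm (g t))) \<in> borel_measurable (lebesgue_on E)"
    and "finite {t \<in> E. L t \<noteq> ln (norm (g t))}"
  shows "integrable (lebesgue_on E) (\<lambda>t. ln (norm (g t))) \<longleftrightarrow> integrable (lebesgue_on E) L"
  using assms ln_norm_redefine_AE[OF assms(1,4)] by (intro integrable_cong_AE)

lemma geom_mean_redefine:
  fixes L :: "real \<Rightarrow> real"
  assumes "E \<in> sets lebesgue"
    and "L \<in> borel_measurable (lebesgue_on E)"
    and "(\<lambda>t. ln (norm (g t))) \<in> borel_measurable (lebesgue_on E)"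
    and "finite {t \<in> E. L t \<noteq> ln (norm (g t))}"
  shows "geom_mean E g = exp (1 / measure lebesgue E * integral\<^sup>L (lebesgue_on E) L)"
  unfolding geom_mean_def
  using integral_cong_AE[OF assms(3,2) ln_norm_redefine_AE[OF assms(1,4)]] by simp

end

theory Submission imports Defs begin

text \<open>
  Let \<open>M = sup |f|\<close> over \<open>D(0,4)\<close>. Recentre at a point \<open>w\<close> of \<open>D(0,1)\<close> with
  \<open>|f w| \<ge> exp (-2 H0) M\<close> and split off a Blaschke factor of the disc of radius 3 for each zero
  \<open>z\<^sub>j\<close> in \<open>D(w,2)\<close>. Jensen's argument gives \<open>N \<le> 6 H0\<close> zeros, and Borel-Caratheodory bounds the
  zero-free quotient from below. Comparing this factorization with the local hypothesis on
  \<open>D(x,h)\<close> bounds \<open>\<Prod>j. |x - z\<^sub>j| + h\<close> from below by \<open>exp (-2 H0 - H1) h ^ d\<close>, hence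
  \<open>ln |f x| \<ge> ln M - 41 (H0 + H1) + d ln h - u x\<close>, where \<open>u x\<close> is the sum of the nonnegative
  functions \<open>ln (h / |x - Re z\<^sub>j|)\<close> truncated at distance \<open>h\<close>. Since \<open>u\<close> has integral \<open>2 h N\<close>,
  averaging over \<open>E\<close> with \<open>h = |E|\<close> gives (ii). Markov's inequality bounds the measure of
  \<open>{u > 6 H0}\<close> by \<open>2 h\<close>, and as \<open>u\<close> is convex between the points \<open>Re z\<^sub>j\<close>, \<open>Re z\<^sub>j \<plusminus> h\<close>, this
  set consists of few intervals; this gives (iii), and (iv) follows by choosing \<open>h\<close>.
\<close>

section \<open>Blaschke factorization\<close>

text \<open>With \<open>a = 3 * b\<close> and \<open>z = 3 * u\<close> this is the usual factor (u -
  b) / (1 - cnj b * u) of the unit disc.\<close>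

definition blaschke :: "complex \<Rightarrow> complex \<Rightarrow> complex" where
  "blaschke a z = 3 * (z - a) / (9 - cnj a * z)"

lemma blaschke_denominator_nonzero:
  assumes "cmod a < 2" "cmod z < 4"
  shows "9 - cnj a * z \<noteq> 0"
proof
  assume "9 - cnj a * z = 0"
  then have "cmod (cnj a * z) = 9"
    by (metis eq_iff_diff_eq_0 norm_numeral)
  moreover have "cmod a * cmod z \<le> 2 * 4"
    using assms by (intro mult_mono) auto
  ultimately show False
    by (simp add: norm_mult)
qed

lemma norm_blaschke: "cmod (blaschke a z) = 3 * cmod (z - a) / cmod (9 - cnj a * z)"
  by (simp add: blaschke_def norm_divide norm_mult del: right_diff_distrib_numeral)

lemma norm_blaschke_sphere:
  assumes "cmod a < 2" "cmod z = 3"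
  shows "cmod (blaschke a z) = 1"
proof -
  have "z * cnj z = 9"
    using complex_norm_square[of z] assms(2) by simp
  then have "9 - cnj a * z = z * cnj (z - a)"
    by (simp add: algebra_simps)
  then have "cmod (9 - cnj a * z) = 3 * cmod (z - a)"
    by (metis norm_mult assms(2) complex_mod_cnj)
  moreover have "z \<noteq> a"
    using assms by auto
  ultimately show ?thesis
    by (simp add: norm_blaschke)
qed

lemma norm_blaschke_le:
  assumes "cmod a < 2" "cmod z \<le> 3"
  shows "cmod (blaschke a z) \<le> cmod (z - a)"
proof -
  have "cmod a * cmod z \<le> 2 * 3"
    using assms by (intro mult_mono) auto
  then have "3 \<le> cmod (9 - cnj a * z)"
    using norm_triangle_ineq2[of 9 "cnj a * z"] by (simp add: norm_mult)
  then have "3 * cmod (z - a) \<le> cmod (z - a) * cmod (9 - cnj a * z)"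
    by (subst mult.commute) (intro mult_left_mono, auto)
  moreover have "cmod (9 - cnj a * z) > 0"
    using \<open>3 \<le> cmod (9 - cnj a * z)\<close> by linarith
  ultimately show ?thesis
    by (simp add: norm_blaschke divide_le_eq)
qed

text \<open>The denominator has modulus at most 9 + 3 = 12. The radius 3/2 covers all differences of
  a point of \<open>I0\<close> and a point of the unit disc, where the centre of the factorization
  will lie.\<close>

lemma norm_blaschke_ge:
  assumes "cmod a < 2" "cmod z \<le> 3/2"
  shows "cmod (z - a) / 4 \<le> cmod (blaschke a z)"
proof -
  have "cmod a * cmod z \<le> 2 * (3/2)"
    using assms by (intro mult_mono) auto
  then have "cmod (9 - cnj a * z) \<le> 12"
    using norm_triangle_ineq4[of 9 "cnj a * z"] by (simp add: norm_mult)
  then have "cmod (z - a) * cmod (9 - cnj a * z) \<le> cmod (z - a) * 12"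
    by (intro mult_left_mono) auto
  moreover have "cmod (9 - cnj a * z) > 0"
    using blaschke_denominator_nonzero[of a z] assms by simp
  ultimately show ?thesis
    by (simp add: norm_blaschke field_simps)
qed

text \<open>The difference quotient removes the zero at \<open>c\<close>. Multiplying it by a third
  of the denominator, which cannot vanish because 2 * 4 < 9, turns the linear factor into a Blaschke
  factor.\<close>

lemma divide_by_blaschke:
  assumes "g holomorphic_on ball 0 4" "g c = 0" "cmod c < 2"
  obtains g' where "g' holomorphic_on ball 0 4"
    "\<And>z. cmod z < 4 \<Longrightarrow> g z = g' z * blaschke c z"
proof -
  define q where "q z = (if z = c then deriv g c else (g z - g c) / (z - c))" for z
  have q: "q holomorphic_on ball 0 4"
    unfolding q_def by (rule pole_lemma_open[OF assms(1)]) simp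
  have "(\<lambda>z. q z * (9 - cnj c * z) / 3) holomorphic_on ball 0 4"
    by (intro holomorphic_intros q) auto
  moreover have "g z = q z * (9 - cnj c * z) / 3 * blaschke c z" if "cmod z < 4" for z
    using blaschke_denominator_nonzero[OF assms(3) that] assms(2)
    by (simp add: blaschke_def q_def del: right_diff_distrib_numeral)
  ultimately show thesis
    by (rule that)
qed

text \<open>The factors have modulus 1 on the circle of radius 3, so the bound on \<open>F\<close>
  passes to \<open>g\<close> there, and inside by the maximum principle. At 0 each factor has
  modulus at most 2/3, so many factors force \<open>F 0\<close> to be small: Jensen's inequality in
  multiplicative form.\<close>

lemma blaschke_quotient_bounds:
  fixes N :: nat
  assumes g: "g holomorphic_on ball 0 4" and a: "\<And>j. j < N \<Longrightarrow> cmod (a j) < 2"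
    and F: "\<And>z. cmod z < 4 \<Longrightarrow> F z = g z * (\<Prod>j<N. blaschke (a j) z)"
    and M: "\<And>z. cmod z \<le> 3 \<Longrightarrow> cmod (F z) \<le> M"
  shows "\<And>z. cmod z \<le> 3 \<Longrightarrow> cmod (g z) \<le> M"
    and "cmod (F 0) \<le> M * (2/3) ^ N" and "cmod (F 0) \<le> cmod (g 0)"
proof -
  show *: "cmod (g z) \<le> M" if "cmod z \<le> 3" for z
  proof (rule maximum_modulus_frontier[where S = "cball 0 3" and f = g])
    show "g holomorphic_on interior (cball 0 3)"
      by (rule holomorphic_on_subset[OF g]) auto
    show "continuous_on (closure (cball 0 3)) g"
      by (rule continuous_on_subset[OF holomorphic_on_imp_continuous_on[OF g]]) auto
    show "cmod (g w) \<le> M" if "w \<in> frontier (cball 0 3)" for w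
    proof -
      have w: "cmod w = 3"
        using that by auto
      then have "(\<Prod>j<N. cmod (blaschke (a j) w)) = 1"
        using a by (intro prod.neutral) (simp add: norm_blaschke_sphere)
      then have "cmod (F w) = cmod (g w)"
        using F[of w] w by (simp add: norm_mult flip: prod_norm)
      then show ?thesis
        using M[of w] w by simp
    qed
  qed (use that in auto)
  have F0: "cmod (F 0) = cmod (g 0) * (\<Prod>j<N. cmod (blaschke (a j) 0))"
    using F[of 0] by (simp add: norm_mult flip: prod_norm)
  have b0: "cmod (blaschke (a j) 0) \<le> 2/3" if "j < N" for j
    using a[OF that] by (simp add: norm_blaschke)
  have P: "(\<Prod>j<N. cmod (blaschke (a j) 0)) \<le> (2/3) ^ N"
    using prod_mono[of "{..<N}" "\<lambda>j. cmod (blaschke (a j) 0)" "\<lambda>_. 2/3"] b0 by simp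
  show "cmod (F 0) \<le> M * (2/3) ^ N"
    unfolding F0 using *[of 0] P by (intro mult_mono) (auto intro: prod_nonneg order_trans[OF norm_ge_zero])
  have "(2/3::real) ^ N \<le> 1"
    by (simp add: power_le_one)
  with P have "(\<Prod>j<N. cmod (blaschke (a j) 0)) \<le> 1"
    by linarith
  then show "cmod (F 0) \<le> cmod (g 0)"
    unfolding F0 using mult_left_mono[of _ 1 "cmod (g 0)"] by simp
qed

text \<open>From e <= 3 < 27/8 one gets 2/3 <= exp (-1/3), so each factor costs at least 1/3 in the
  exponent.\<close>

lemma two_thirds_power_bound:
  assumes "exp (- 2 * H) \<le> (2/3::real) ^ N"
  shows "real N \<le> 6 * H"
proof -
  have "(2/3::real) \<le> exp (- 1/3)"
  proof -
    have "exp (1/3::real) ^ 3 = exp 1"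
      by (simp flip: exp_of_nat_mult)
    also have "\<dots> \<le> (3/2) ^ 3"
      using exp_le by (simp add: power3_eq_cube)
    finally have "exp (1/3::real) \<le> 3/2"
      using power_mono_iff[of "exp (1/3::real)" "3/2" 3] by simp
    then show ?thesis
      by (simp add: exp_minus field_simps)
  qed
  then have "(2/3::real) ^ N \<le> exp (- 1/3) ^ N"
    by (intro power_mono) auto
  also have "\<dots> = exp (- real N / 3)"
    by (simp flip: exp_of_nat_mult)
  finally have "exp (- 2 * H) \<le> exp (- real N / 3)"
    using assms by linarith
  then show ?thesis
    by simp
qed

text \<open>A factorization with the largest possible number of factors leaves no further zero.\<close>

lemma blaschke_factorization:
  assumes F: "F holomorphic_on ball 0 4" and M: "M > 0" "\<And>z. cmod z \<le> 3 \<Longrightarrow> cmod (F z) \<le> M"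
    and F0: "exp (- 2 * H) * M \<le> cmod (F 0)"
  obtains N :: nat and a g where "real N \<le> 6 * H" "\<And>j. j < N \<Longrightarrow> cmod (a j) < 2"
    "g holomorphic_on ball 0 4" "\<And>z. cmod z < 4 \<Longrightarrow> F z = g z * (\<Prod>j<N. blaschke (a j) z)"
    "\<And>z. cmod z \<le> 3 \<Longrightarrow> cmod (g z) \<le> M" "exp (- 2 * H) * M \<le> cmod (g 0)"
    "\<And>z. cmod z < 2 \<Longrightarrow> g z \<noteq> 0"
proof -
  \<comment> \<open>The points \<open>a j\<close> may repeat, so a multiple zero simply contributes
    several factors.\<close>
  define P where "P N \<longleftrightarrow> (\<exists>a g. (\<forall>j<N. cmod (a j) < 2) \<and> g holomorphic_on ball 0 4 \<and>
      (\<forall>z. cmod z < 4 \<longrightarrow> F z = g z * (\<Prod>j<N. blaschke (a j) z)))" for N :: nat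
  have bound: "real N \<le> 6 * H" if "P N" for N
  proof -
    obtain a g where "\<And>j. j < N \<Longrightarrow> cmod (a j) < 2" "g holomorphic_on ball 0 4"
      "\<And>z. cmod z < 4 \<Longrightarrow> F z = g z * (\<Prod>j<N. blaschke (a j) z)"
      using \<open>P N\<close> unfolding P_def by blast
    from blaschke_quotient_bounds(2)[OF this(2,1,3) M(2)] F0
    have "exp (- 2 * H) * M \<le> (2/3) ^ N * M"
      by (simp add: mult.commute)
    then show ?thesis
      using M(1) by (intro two_thirds_power_bound) simp
  qed
  have "P 0"
    unfolding P_def using F by auto
  moreover have "\<forall>N. P N \<longrightarrow> N \<le> nat \<lceil>6 * H\<rceil>"
    using bound by (metis of_nat_le_iff order.trans real_nat_ceiling_ge)
  ultimately obtain N where N: "P N" and max: "\<And>n. P n \<Longrightarrow> n \<le> N"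
    using Nat.ex_has_greatest_nat[of P 0] by blast
  obtain a g where a: "\<And>j. j < N \<Longrightarrow> cmod (a j) < 2" and g: "g holomorphic_on ball 0 4"
    and Fg: "\<And>z. cmod z < 4 \<Longrightarrow> F z = g z * (\<Prod>j<N. blaschke (a j) z)"
    using N unfolding P_def by blast
  have nz: "g c \<noteq> 0" if c: "cmod c < 2" for c
  proof
    assume "g c = 0"
    then obtain g' where g': "g' holomorphic_on ball 0 4"
      "\<And>z. cmod z < 4 \<Longrightarrow> g z = g' z * blaschke c z"
      using divide_by_blaschke[OF g _ c] by blast
    have "P (Suc N)"
      unfolding P_def
    proof (intro exI[of _ "a(N := c)"] exI[of _ g'] conjI allI impI)
      show "F z = g' z * (\<Prod>j<Suc N. blaschke ((a(N := c)) j) z)" if "cmod z < 4" for z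
        using Fg[OF that] g'(2)[OF that] by (simp add: algebra_simps)
    qed (use a c g' in \<open>auto simp: less_Suc_eq\<close>)
    with max show False
      by fastforce
  qed
  note gb = blaschke_quotient_bounds[OF g a Fg M(2)]
  show thesis
    by (rule that[OF bound[OF N] a g Fg gb(1) _ nz]) (use gb(3) F0 in auto)
qed

text \<open>The Borel-Caratheodory argument: the Cayley transform maps the half plane
  \<open>Re w < 0\<close> to the unit disc, where the Schwarz lemma applies.\<close>

lemma log_lower_bound:
  assumes L: "L holomorphic_on ball 0 2" and neg: "\<And>z. cmod z < 2 \<Longrightarrow> Re (L z) < 0"
    and z: "cmod z \<le> 3/2"
  shows "7 * Re (L 0) \<le> Re (L z)"
proof -
  define a where "a = L 0"
  define \<phi> where "\<phi> u = (L (2 * u) - a) / (L (2 * u) + cnj a)" for u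
  have a: "Re a < 0"
    unfolding a_def using neg[of 0] by simp
  have in2: "cmod (2 * u) < 2" if "cmod u < 1" for u
    using that by (simp add: norm_mult)
  have den: "L (2 * u) + cnj a \<noteq> 0" if "cmod u < 1" for u
    using neg[OF in2[OF that]] a by (auto simp: complex_eq_iff)
  have "(\<lambda>u. L (2 * u)) holomorphic_on ball 0 1"
    by (rule holomorphic_on_compose_gen[of "\<lambda>u. 2 * u" _ L "ball 0 2", unfolded o_def])
      (auto intro!: holomorphic_intros L simp: norm_mult)
  then have hol: "\<phi> holomorphic_on ball 0 1"
    unfolding \<phi>_def using den by (intro holomorphic_intros) auto
  have lt: "cmod (\<phi> u) < 1" if "cmod u < 1" for u
  proof -
    have r: "Re (L (2 * u)) < 0"
      using neg[OF in2[OF that]] .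
    \<comment> \<open>The right square exceeds the left one by 4 * Re (L (2 * u)) * Re a, and both
      real parts are negative.\<close>
    have "(cmod (L (2 * u) - a))\<^sup>2 < (cmod (L (2 * u) + cnj a))\<^sup>2"
      unfolding cmod_power2 using mult_neg_neg[OF r a]
      by (simp add: power2_eq_square algebra_simps)
    then have "cmod (L (2 * u) - a) < cmod (L (2 * u) + cnj a)"
      by (rule power2_less_imp_less) simp
    then show ?thesis
      using den[OF that] by (simp add: \<phi>_def norm_divide)
  qed
  define u where "u = z / 2"
  have u: "cmod u \<le> 3/4" "L (2 * u) = L z"
    using z by (auto simp: u_def norm_divide)
  have "cmod (\<phi> u) \<le> cmod u"
    using u(1) by (intro Schwarz_Lemma(1)[OF hol _ lt]) (auto simp: \<phi>_def a_def)
  then have "cmod (L z - a) \<le> cmod u * cmod (L z + cnj a)"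
    using den[of u] u by (simp add: \<phi>_def norm_divide divide_le_eq)
  also have "\<dots> \<le> 3/4 * cmod (L z + cnj a)"
    using u(1) by (intro mult_right_mono) auto
  also have "cmod (L z + cnj a) \<le> cmod (L z - a) + cmod (a + cnj a)"
    using norm_triangle_ineq[of "L z - a" "a + cnj a"] by simp
  also have "cmod (a + cnj a) = - 2 * Re a"
    using a by (simp add: complex_add_cnj)
  \<comment> \<open>X <= 3/4 * (X + 2 * |Re a|) gives X <= 6 * |Re a|. Adding |Re a| itself explains
    the factor 7.\<close>
  finally have "cmod (L z - a) \<le> - 6 * Re a"
    by simp
  moreover have "Re a - Re (L z) \<le> cmod (L z - a)"
    using abs_Re_le_cmod[of "L z - a"] by simp
  ultimately show ?thesis
    by (simp add: a_def)
qed

lemma nonvanishing_lower_bound: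
  assumes g: "g holomorphic_on ball 0 4" and M: "M > 0" "\<And>z. cmod z \<le> 3 \<Longrightarrow> cmod (g z) \<le> M"
    and nz: "\<And>z. cmod z < 2 \<Longrightarrow> g z \<noteq> 0"
    and g0: "exp (- 2 * H) * M \<le> cmod (g 0)" and H: "H \<ge> 1" and z: "cmod z \<le> 3/2"
  shows "exp (- 21 * H) * M \<le> cmod (g z)"
proof -
  have "g holomorphic_on ball 0 2"
    by (rule holomorphic_on_subset[OF g]) auto
  \<comment> \<open>Dividing by e * M instead of M makes the real part of the logarithm strictly
    negative.\<close>
  then have "(\<lambda>z. g z / (exp 1 * of_real M)) holomorphic_on ball 0 2"
    using M by (intro holomorphic_intros) auto
  moreover have "g z / (exp 1 * of_real M) \<noteq> 0" if "z \<in> ball 0 2" for z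
    using nz[of z] M that by auto
  ultimately obtain L where L: "L holomorphic_on ball 0 2"
    and "\<And>z. z \<in> ball 0 2 \<Longrightarrow> exp (L z) = g z / (exp 1 * of_real M)"
    by (rule holomorphic_logarithm_exists[OF convex_ball open_ball, where ?z0.0 = 0]) auto
  then have "cmod (exp (L z)) = cmod (g z) / (exp 1 * M)" if "cmod z < 2" for z
    using that M by (simp add: norm_divide norm_mult)
  then have ReL: "cmod (g z) = exp (1 + Re (L z)) * M" if "cmod z < 2" for z
    using that M by (simp add: exp_add field_simps)
  have "Re (L z) < 0" if "cmod z < 2" for z
  proof -
    have "exp (1 + Re (L z)) * M \<le> 1 * M"
      using M(2)[of z] ReL[OF that] that by simp
    then have "exp (1 + Re (L z)) \<le> 1"
      using M(1) mult_le_cancel_right_pos by blast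
    then show ?thesis
      by simp
  qed
  then have "7 * Re (L 0) \<le> Re (L z)"
    by (rule log_lower_bound[OF L _ z])
  moreover have "exp (- 2 * H) * M \<le> exp (1 + Re (L 0)) * M"
    using g0 ReL[of 0] by simp
  then have "- 2 * H \<le> 1 + Re (L 0)"
    using M(1) by simp
  \<comment> \<open>7 * (- 2 * H - 1) + 1 = - 14 * H - 6, which is at least - 21 * H because H >=
    1.\<close>
  ultimately have "- 21 * H \<le> 1 + Re (L z)"
    using H by simp
  then show ?thesis
    using ReL[of z] z M(1) by simp
qed

section \<open>Logarithmic wells\<close>

text \<open>For h > 0 and t nonzero, \<open>exp (- log_well h t)\<close> is the minimum of 1 and |t|
  / h. At t = 0 the conventions for division and \<open>ln\<close> give the value 0 instead of
  infinity; this is harmless for integrals, but pointwise lower bounds must exclude the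
  centres.\<close>

definition log_well :: "real \<Rightarrow> real \<Rightarrow> real" where
  "log_well h t = (if \<bar>t\<bar> < h then ln (h / \<bar>t\<bar>) else 0)"

lemma log_well_nonneg: "0 \<le> log_well h t"
proof (cases "t = 0")
  case False
  then show ?thesis
    by (auto simp: log_well_def intro!: ln_ge_zero)
qed (simp add: log_well_def)

text \<open>This is the singular term in the antiderivative of a well; continuity at 0 lets the
  fundamental theorem of calculus be applied across the centre.\<close>

lemma continuous_on_mult_ln_abs:
  "continuous_on UNIV (\<lambda>t::real. t * ln \<bar>t\<bar>)"
proof -
  have lim: "((\<lambda>t::real. t * ln \<bar>t\<bar>) \<longlongrightarrow> 0) (at 0)"
  proof (rule filterlim_split_at)
    show "((\<lambda>t::real. t * ln \<bar>t\<bar>) \<longlongrightarrow> 0) (at_left 0)"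
      by real_asymp
    show "((\<lambda>t::real. t * ln \<bar>t\<bar>) \<longlongrightarrow> 0) (at_right 0)"
      by real_asymp
  qed
  have "isCont (\<lambda>t::real. t * ln \<bar>t\<bar>) x" for x
    by (cases "x = 0") (use lim in \<open>auto simp: isCont_def intro!: continuous_intros tendsto_intros\<close>)
  then show ?thesis
    by (simp add: continuous_at_imp_continuous_on)
qed

lemma has_integral_log_well:
  assumes h: "h > 0"
  shows "((\<lambda>x. log_well h (x - c)) has_integral 2 * h) UNIV"
proof -
  \<comment> \<open>\<open>G\<close> is an antiderivative of ln (h / |x - c|) away from
    \<open>c\<close>, normalized so that its values at c + h and c - h are h and - h.\<close>
  define G where "G x = (x - c) * ln h - (x - c) * ln \<bar>x - c\<bar> + (x - c)" for x
  have "(log_well h \<circ> (\<lambda>x. x - c) has_integral G (c + h) - G (c - h)) {c - h..c + h}"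
  proof (rule fundamental_theorem_of_calculus_interior_strong[of "{c}"])
    show "continuous_on {c - h..c + h} G"
      unfolding G_def
      by (intro continuous_intros continuous_on_compose2[OF continuous_on_mult_ln_abs]) auto
    fix x assume x: "x \<in> {c - h<..<c + h} - {c}"
    have "(G has_real_derivative ln h - ln \<bar>x - c\<bar>) (at x)"
    proof (cases "x > c")
      case True
      have "((\<lambda>x. (x - c) * ln h - (x - c) * ln (x - c) + (x - c)) has_real_derivative
          ln h - ln (x - c)) (at x)"
        using True by (auto intro!: derivative_eq_intros)
      then have "((\<lambda>x. (x - c) * ln h - (x - c) * ln (x - c) + (x - c)) has_real_derivative
          ln h - ln \<bar>x - c\<bar>) (at x)"
        using True by simp
      then show ?thesis
        by (rule has_field_derivative_transform_within_open[of _ _ _ "{c<..}"])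
          (use True in \<open>auto simp: G_def\<close>)
    next
      case False
      then have "x < c"
        using x by auto
      then have "((\<lambda>x. (x - c) * ln h + (c - x) * ln (c - x) + (x - c)) has_real_derivative
          ln h - ln (c - x)) (at x)"
        by (auto intro!: derivative_eq_intros)
      then have "((\<lambda>x. (x - c) * ln h + (c - x) * ln (c - x) + (x - c)) has_real_derivative
          ln h - ln \<bar>x - c\<bar>) (at x)"
        using \<open>x < c\<close> by simp
      then show ?thesis
        by (rule has_field_derivative_transform_within_open[of _ _ _ "{..<c}"])
          (use \<open>x < c\<close> in \<open>auto simp: G_def algebra_simps\<close>)
    qed
    moreover have "ln h - ln \<bar>x - c\<bar> = (log_well h \<circ> (\<lambda>x. x - c)) x"
      using x h by (auto simp: log_well_def ln_div)
    ultimately show "(G has_vector_derivative (log_well h \<circ> (\<lambda>x. x - c)) x) (at x)"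
      by (simp add: has_real_derivative_iff_has_vector_derivative)
  qed (use h in auto)
  moreover have "G (c + h) - G (c - h) = 2 * h"
    using h by (simp add: G_def)
  ultimately have "((\<lambda>x. log_well h (x - c)) has_integral 2 * h) {c - h..c + h}"
    by (simp add: o_def)
  then show ?thesis
    by (rule has_integral_on_superset) (auto simp: log_well_def)
qed

lemma sum_log_well_integrable:
  fixes N :: nat
  assumes "h > 0"
  shows "integrable lebesgue (\<lambda>x. \<Sum>j<N. log_well h (x - c j))"
    and "(LINT x|lebesgue. (\<Sum>j<N. log_well h (x - c j))) = 2 * h * N"
proof -
  have "((\<lambda>x. \<Sum>j<N. log_well h (x - c j)) has_integral (\<Sum>j<N. 2 * h)) UNIV"
    by (intro has_integral_sum has_integral_log_well[OF assms]) auto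
  then have int: "((\<lambda>x. \<Sum>j<N. log_well h (x - c j)) has_integral 2 * h * N) UNIV"
    by (simp add: mult_ac)
  have abs: "(\<lambda>x. \<Sum>j<N. log_well h (x - c j)) absolutely_integrable_on UNIV"
    using int by (intro nonnegative_absolutely_integrable_1) (auto intro!: sum_nonneg log_well_nonneg)
  show "integrable lebesgue (\<lambda>x. \<Sum>j<N. log_well h (x - c j))"
    using abs by (simp add: set_integrable_def)
  show "(LINT x|lebesgue. (\<Sum>j<N. log_well h (x - c j))) = 2 * h * N"
    using set_lebesgue_integral_eq_integral(2)[OF abs] int
    by (simp add: set_lebesgue_integral_def integral_unique)
qed

text \<open>The total mass is 2 * h * N and the threshold is at least N, so Markov's inequality
  leaves 2 * h, whatever the number of wells.\<close>

lemma sum_log_well_superlevel_measure: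
  fixes N :: nat
  assumes h: "h > 0" and T: "real N \<le> T" "T > 0"
  shows "{x. T < (\<Sum>j<N. log_well h (x - c j))} \<in> lmeasurable"
    and "measure lebesgue {x. T < (\<Sum>j<N. log_well h (x - c j))} \<le> 2 * h"
proof -
  let ?u = "\<lambda>x. \<Sum>j<N. log_well h (x - c j)"
  note u = sum_log_well_integrable[OF h, where N = N and c = c]
  have meas: "{x. T < ?u x} \<in> sets lebesgue" "{x. T \<le> ?u x} \<in> sets lebesgue"
    using borel_measurable_integrable[OF u(1), unfolded borel_measurable_iff_greater, rule_format, of T]
      borel_measurable_integrable[OF u(1), unfolded borel_measurable_iff_ge, rule_format, of T] by simp_all
  have "emeasure lebesgue {x \<in> space lebesgue. T \<le> ?u x} \<le> ennreal (1 / T * (LINT x|lebesgue. ?u x))"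
    by (rule integral_Markov_inequality[OF u(1) _ T(2)]) (auto intro!: sum_nonneg log_well_nonneg)
  then have "emeasure lebesgue {x. T \<le> ?u x} \<le> ennreal (1 / T * (2 * h * N))"
    by (simp add: u(2))
  also have "1 / T * (2 * h * N) \<le> 2 * h"
    using T h by (simp add: field_simps)
  finally have em: "emeasure lebesgue {x. T \<le> ?u x} \<le> ennreal (2 * h)"
    by (simp add: ennreal_leI)
  have "emeasure lebesgue {x. T < ?u x} \<le> emeasure lebesgue {x. T \<le> ?u x}"
    by (intro emeasure_mono meas) auto
  with em have em': "emeasure lebesgue {x. T < ?u x} \<le> ennreal (2 * h)"
    by simp
  show "{x. T < ?u x} \<in> lmeasurable"
    using meas(1) le_less_trans[OF em' ennreal_less_top] by (simp add: fmeasurable_def)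
  show "measure lebesgue {x. T < ?u x} \<le> 2 * h"
    unfolding measure_def using em' h by (intro enn2real_leI) auto
qed

lemma convex_on_log_well:
  assumes J: "is_interval J" "c \<notin> J" "c - h \<notin> J" "c + h \<notin> J" and h: "h > 0"
  shows "convex_on J (\<lambda>x. log_well h (x - c))"
proof -
  have J': "convex J"
    using J(1) is_interval_convex by blast
  have mem: "z \<in> J" if "x \<in> J" "y \<in> J" "x \<le> z" "z \<le> y" for x y z
    using J(1) that unfolding is_interval_1 by blast
  have ln: "- ln ((1 - t) * x + t * y) \<le> (1 - t) * - ln x + t * - ln y"
    if "0 < t" "t < 1" "0 < x" "0 < y" for t x y :: real
    using concave_onD[OF ln_concave, of t x y] that by simp
  \<comment> \<open>An interval avoiding the three points lies outside the window, where the well is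
    0, or inside one half of it, where the well is a constant minus the logarithm of the distance to
    \<open>c\<close>.\<close>
  consider "\<forall>x\<in>J. \<bar>x - c\<bar> \<ge> h" | "J \<subseteq> {c<..<c + h}" | "J \<subseteq> {c - h<..<c}"
  proof (cases "\<forall>x\<in>J. \<bar>x - c\<bar> \<ge> h")
    case False
    then obtain x where x: "x \<in> J" "c - h < x" "x < c + h"
      by (auto simp: not_le abs_less_iff)
    have "x \<noteq> c"
      using x J by auto
    then consider "x < c" | "x > c"
      by linarith
    then show ?thesis
    proof cases
      case 1
      then have "J \<subseteq> {c - h<..<c}"
        using x J mem[of x _ c] mem[of _ x "c - h"]
        by (smt (verit, best) greaterThanLessThan_iff subsetI)
      then show ?thesis by (rule that)
    next
      case 2
      then have "J \<subseteq> {c<..<c + h}"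
        using x J mem[of x _ "c + h"] mem[of _ x c]
        by (smt (verit, best) greaterThanLessThan_iff subsetI)
      then show ?thesis by (rule that)
    qed
  qed (rule that)
  then show ?thesis
  proof cases
    case 1
    then have eq: "log_well h (x - c) = 0" if "x \<in> J" for x
      using that by (auto simp: log_well_def)
    show ?thesis
    proof (rule convex_onI[OF _ J'])
      fix t x y :: real assume *: "0 < t" "t < 1" "x \<in> J" "y \<in> J"
      have "(1 - t) *\<^sub>R x + t *\<^sub>R y \<in> J"
        using convexD_alt[OF J' *(3,4)] * by simp
      then show "log_well h ((1 - t) *\<^sub>R x + t *\<^sub>R y - c)
          \<le> (1 - t) * log_well h (x - c) + t * log_well h (y - c)"
        using eq * by simp
    qed
  next
    case 2
    have eq: "log_well h (x - c) = ln h - ln (x - c)" if "x \<in> J" for x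
      using 2 that h by (auto simp: log_well_def ln_div)
    show ?thesis
    proof (rule convex_onI[OF _ J'])
      fix t x y :: real assume *: "0 < t" "t < 1" "x \<in> J" "y \<in> J"
      have m: "(1 - t) *\<^sub>R x + t *\<^sub>R y \<in> J"
        using convexD_alt[OF J' *(3,4)] * by simp
      have "- ln ((1 - t) * (x - c) + t * (y - c)) \<le> (1 - t) * - ln (x - c) + t * - ln (y - c)"
        using 2 * by (intro ln) auto
      then show "log_well h ((1 - t) *\<^sub>R x + t *\<^sub>R y - c)
          \<le> (1 - t) * log_well h (x - c) + t * log_well h (y - c)"
        unfolding eq[OF m] eq[OF *(3)] eq[OF *(4)] by (simp add: algebra_simps)
    qed
  next
    case 3
    have eq: "log_well h (x - c) = ln h - ln (c - x)" if "x \<in> J" for x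
      using 3 that h by (auto simp: log_well_def ln_div)
    show ?thesis
    proof (rule convex_onI[OF _ J'])
      fix t x y :: real assume *: "0 < t" "t < 1" "x \<in> J" "y \<in> J"
      have m: "(1 - t) *\<^sub>R x + t *\<^sub>R y \<in> J"
        using convexD_alt[OF J' *(3,4)] * by simp
      have "- ln ((1 - t) * (c - x) + t * (c - y)) \<le> (1 - t) * - ln (c - x) + t * - ln (c - y)"
        using 3 * by (intro ln) auto
      then show "log_well h ((1 - t) *\<^sub>R x + t *\<^sub>R y - c)
          \<le> (1 - t) * log_well h (x - c) + t * log_well h (y - c)"
        unfolding eq[OF m] eq[OF *(3)] eq[OF *(4)] by (simp add: algebra_simps)
    qed
  qed
qed

lemma convex_on_sum_log_well:
  fixes N :: nat
  assumes "is_interval J" "\<And>j. j < N \<Longrightarrow> c j \<notin> J \<and> c j - h \<notin> J \<and> c j + h \<notin> J" "h > 0"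
  shows "convex_on J (\<lambda>x. \<Sum>j<N. log_well h (x - c j))"
  using assms(2)
proof (induction N)
  case 0
  then show ?case
    using assms(1) by (simp add: is_interval_convex convex_on_const)
next
  case (Suc N)
  then show ?case
    using assms by (auto intro!: convex_on_add convex_on_log_well)
qed

section \<open>Counting the intervals that make up a set\<close>

lemma interval_diff_interval:
  fixes K D :: "real set"
  assumes K: "is_interval K" and D: "is_interval D" "D \<subseteq> K"
  obtains J\<^sub>1 J\<^sub>2 where "is_interval J\<^sub>1" "is_interval J\<^sub>2" "K - D = J\<^sub>1 \<union> J\<^sub>2"
proof -
  have K': "z \<in> K" if "x \<in> K" "y \<in> K" "x \<le> z" "z \<le> y" for x y z
    using K that unfolding is_interval_1 by blast
  have D': "z \<in> D" if "x \<in> D" "y \<in> D" "x \<le> z" "z \<le> y" for x y z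
    using D(1) that unfolding is_interval_1 by blast
  have "is_interval {x \<in> K. \<forall>y\<in>D. x < y}"
    unfolding is_interval_1 mem_Collect_eq
    by (intro ballI allI impI conjI) (auto simp only: mem_Collect_eq elim: K' dest: le_less_trans)
  moreover have "is_interval {x \<in> K. \<forall>y\<in>D. y < x}"
    unfolding is_interval_1 mem_Collect_eq
    by (intro ballI allI impI conjI) (auto simp only: mem_Collect_eq elim: K' dest: less_le_trans)
  moreover have "K - D = {x \<in> K. \<forall>y\<in>D. x < y} \<union> {x \<in> K. \<forall>y\<in>D. y < x}"
  proof (intro equalityI subsetI)
    fix x assume x: "x \<in> K - D"
    have "(\<forall>y\<in>D. x < y) \<or> (\<forall>y\<in>D. y < x)"
    proof (rule ccontr)
      assume "\<not> ((\<forall>y\<in>D. x < y) \<or> (\<forall>y\<in>D. y < x))"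
      then obtain y z where "y \<in> D" "z \<in> D" "y \<le> x" "x \<le> z"
        unfolding not_less de_Morgan_disj ball_simps by blast
      with x D' show False
        by blast
    qed
    with x show "x \<in> {x \<in> K. \<forall>y\<in>D. x < y} \<union> {x \<in> K. \<forall>y\<in>D. y < x}"
      by simp
  qed auto
  ultimately show thesis
    by (rule that)
qed

text \<open>Between consecutive points of \<open>B\<close> the complement of \<open>S\<close> is an
  interval, so \<open>S\<close> contributes at most two intervals there. With k points this makes 2
  * (k + 1) pieces from the gaps and k single points, that is 3 * k + 2.\<close>

lemma union_of_few_intervals:
  fixes B K S :: "real set"
  assumes "finite B" "is_interval K" "S \<subseteq> K"
    and "\<And>J. is_interval J \<Longrightarrow> J \<subseteq> K \<Longrightarrow> J \<inter> B = {} \<Longrightarrow> is_interval (J - S)"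
  shows "\<exists>\<J>. S = \<Union>\<J> \<and> finite \<J> \<and> card \<J> \<le> 3 * card B + 2 \<and> (\<forall>J\<in>\<J>. is_interval J)"
  using assms
proof (induction B arbitrary: K S rule: finite_linorder_max_induct)
  case empty
  then have "is_interval (K - S)"
    by blast
  then obtain J\<^sub>1 J\<^sub>2 where "is_interval J\<^sub>1" "is_interval J\<^sub>2" "K - (K - S) = J\<^sub>1 \<union> J\<^sub>2"
    using interval_diff_interval[OF empty(1)] by (metis Diff_subset)
  moreover have "K - (K - S) = S"
    using empty by auto
  ultimately show ?case
    by (intro exI[of _ "{J\<^sub>1, J\<^sub>2}"]) (auto simp: card_insert_if)
next
  case (insert b B)
  have L: "is_interval (K \<inter> {..<b})" and R: "is_interval (K \<inter> {b<..})"
    using insert.prems(1) by (auto intro!: is_interval_Int)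
  have "is_interval (J - S \<inter> {..<b})" if "is_interval J" "J \<subseteq> K \<inter> {..<b}" "J \<inter> B = {}" for J
  proof -
    have "J - S \<inter> {..<b} = J - S"
      using that by auto
    then show ?thesis
      using insert.prems(3)[of J] that by auto
  qed
  then obtain \<J> where \<J>: "S \<inter> {..<b} = \<Union>\<J>" "finite \<J>" "card \<J> \<le> 3 * card B + 2"
    "\<forall>J\<in>\<J>. is_interval J"
    using insert.IH[OF L, of "S \<inter> {..<b}"] insert.prems(2) by auto
  \<comment> \<open>The induction adds points in increasing order, so no point of \<open>B\<close>
    lies to the right of \<open>b\<close>. That side yields two intervals, and with the part of
    \<open>S\<close> at \<open>b\<close> the count grows by three.\<close>
  have "is_interval (K \<inter> {b<..} - S)"
    using insert.prems(3)[OF R] insert.hyps(2) by fastforce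
  then obtain J\<^sub>1 J\<^sub>2 where J: "is_interval J\<^sub>1" "is_interval J\<^sub>2"
    "K \<inter> {b<..} - (K \<inter> {b<..} - S) = J\<^sub>1 \<union> J\<^sub>2"
    using interval_diff_interval[OF R] by (metis Diff_subset)
  have "K \<inter> {b<..} - (K \<inter> {b<..} - S) = S \<inter> {b<..}"
    using insert.prems(2) by auto
  with J have J12: "S \<inter> {b<..} = J\<^sub>1 \<union> J\<^sub>2"
    by simp
  have pt: "is_interval (S \<inter> {b})"
    by (auto simp: is_interval_1)
  have S: "S = \<Union>(insert (S \<inter> {b}) (insert J\<^sub>1 (insert J\<^sub>2 \<J>)))"
  proof -
    have "\<Union>(insert (S \<inter> {b}) (insert J\<^sub>1 (insert J\<^sub>2 \<J>)))
        = S \<inter> {b} \<union> (S \<inter> {b<..} \<union> S \<inter> {..<b})"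
      unfolding J12 \<J>(1) by (simp add: Un_assoc)
    also have "\<dots> = S"
      by auto
    finally show ?thesis ..
  qed
  have card: "card (insert (S \<inter> {b}) (insert J\<^sub>1 (insert J\<^sub>2 \<J>))) \<le> 3 * card (insert b B) + 2"
  proof -
    have "card (insert (S \<inter> {b}) (insert J\<^sub>1 (insert J\<^sub>2 \<J>))) \<le> card \<J> + 3"
      using \<J>(2) by (simp add: card_insert_if)
    moreover have "card (insert b B) = card B + 1"
      using insert.hyps by (subst card_insert_disjoint) auto
    ultimately show ?thesis
      using \<J>(3) by linarith
  qed
  show ?case
    by (rule exI, intro conjI, rule S, use \<J>(2) in simp, rule card) (use \<J>(4) J(1,2) pt in blast)
qed

section \<open>The pointwise lower bound\<close>

text \<open>This exchanges the factor D + h supplied by the local hypothesis for the factor D / 4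
  that bounds a Blaschke factor from below. The core is (D + h) * min 1 (|t| / h) <= 2 * D.\<close>

lemma log_well_ratio:
  assumes D: "\<bar>t\<bar> \<le> D" "t \<noteq> 0" and h: "h > 0"
  shows "(D + h) / 8 * exp (- log_well h t) \<le> D / 4"
proof (cases "\<bar>t\<bar> < h")
  case True
  then have e: "exp (- log_well h t) = \<bar>t\<bar> / h"
    using assms by (simp add: log_well_def exp_minus)
  show ?thesis
  proof (cases "D < h")
    case True
    have "(D + h) * \<bar>t\<bar> \<le> (2 * h) * D"
      using True D h by (intro mult_mono) auto
    then show ?thesis
      unfolding e using h by (simp add: field_simps)
  next
    case False
    have "(D + h) * \<bar>t\<bar> \<le> (2 * D) * h"
      using False D h \<open>\<bar>t\<bar> < h\<close> by (intro mult_mono) auto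
    then show ?thesis
      unfolding e using h by (simp add: field_simps)
  qed
qed (use assms in \<open>auto simp: log_well_def\<close>)

lemma exp_minus_three_power_le: "exp (- 3 * real N) \<le> (1/8) ^ N"
proof -
  have "(2::real) ^ 3 \<le> exp 1 ^ 3"
    using exp_ge_add_one_self[of 1] by (intro power_mono) auto
  then have "exp (- 3) \<le> (1/8 :: real)"
    by (simp add: exp_minus field_simps flip: exp_of_nat_mult)
  then have "exp (- 3) ^ N \<le> (1/8 :: real) ^ N"
    by (intro power_mono) auto
  then show ?thesis
    by (simp add: mult.commute flip: exp_of_nat_mult)
qed

text \<open>Real suprema carry information only for bounded sets. The radius 9/2 accommodates every
  disc of radius 4 centred in \<open>I0\<close>.\<close>

lemma bdd_above_norm_image_ball:
  assumes "f holomorphic_on ball 0 5" "S \<subseteq> cball 0 (9/2)"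
  shows "bdd_above ((\<lambda>z. cmod (f z)) ` S)"
proof -
  have "continuous_on (cball 0 (9/2)) (\<lambda>z. cmod (f z))"
    by (intro continuous_on_norm continuous_on_subset[OF holomorphic_on_imp_continuous_on[OF assms(1)]]) auto
  then have "bdd_above ((\<lambda>z. cmod (f z)) ` cball 0 (9/2))"
    by (intro bounded_imp_bdd_above compact_imp_bounded compact_continuous_image compact_cball)
  then show ?thesis
    using assms(2) by (meson bdd_above_mono image_mono)
qed

text \<open>One choice of \<open>N\<close>, \<open>c\<close> and \<open>M\<close> serves all
  \<open>x\<close> and \<open>h\<close>. The centres are the real parts of the zeros found, so for
  real \<open>x\<close> the distance to a centre is at most the distance to the zero.\<close>

lemma log_well_lower_bound:
  fixes f :: "complex \<Rightarrow> complex" and d :: nat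
  assumes hol: "f holomorphic_on ball 0 5" and nz: "\<exists>z\<in>ball 0 5. f z \<noteq> 0"
    and H0: "H0 \<ge> 1" and H1: "H1 \<ge> 0"
    and glob: "(SUP z\<in>ball 0 4. cmod (f z)) \<le> exp H0 * (SUP z\<in>ball 0 1. cmod (f z))"
    and loc: "\<forall>x\<in>I0. \<forall>r::real. 0 < r \<and> r \<le> 1 \<longrightarrow>
         (SUP z\<in>ball (of_real x) 4. cmod (f z))
           \<le> exp H1 * r powi (- int d) * (SUP z\<in>ball (of_real x) r. cmod (f z))"
  obtains N :: nat and c M where "real N \<le> 6 * H0" "M > 0" "\<And>x. x \<in> I0 \<Longrightarrow> cmod (f (of_real x)) \<le> M"
    "\<And>x h. x \<in> I0 \<Longrightarrow> 0 < h \<Longrightarrow> h \<le> 1 \<Longrightarrow> x \<notin> c ` {..<N} \<Longrightarrow>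
      M * exp (- (41 * (H0 + H1))) * h ^ d * exp (- (\<Sum>j<N. log_well h (x - c j))) \<le> cmod (f (of_real x))"
proof -
  define M where "M = (SUP z\<in>ball 0 4. cmod (f z))"
  have le_M: "cmod (f z) \<le> M" if "cmod z < 4" for z
    unfolding M_def using that by (intro cSUP_upper bdd_above_norm_image_ball[OF hol]) auto
  have M: "M > 0"
  proof (rule ccontr)
    assume "\<not> M > 0"
    then have "f z = 0" if "z \<in> ball 0 4" for z
      using le_M[of z] that norm_ge_zero[of "f z"] by (metis dist_0_norm mem_ball norm_le_zero_iff order_trans not_less)
    moreover have "(0::complex) islimpt ball 0 4"
      by (simp add: islimpt_ball)
    ultimately have "f z = 0" if "z \<in> ball 0 5" for z
      by (intro analytic_continuation[OF hol open_ball connected_ball _ _ _ _ that, of "ball 0 4" 0]) auto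
    with nz show False by blast
  qed
  obtain w where w: "cmod w < 1" "exp (- 2 * H0) * M < cmod (f w)"
  proof -
    \<comment> \<open>The supremum over the open disc need not be attained; giving up a second
      factor exp (- H0) makes the inequality strict and so produces \<open>w\<close>.\<close>
    have "exp (- 2 * H0) * M < exp (- H0) * M"
      using M H0 by simp
    also have "\<dots> \<le> (SUP z\<in>ball 0 1. cmod (f z))"
      using glob by (simp add: M_def exp_minus field_simps)
    finally show thesis
      using that by (subst (asm) less_cSUP_iff) (auto intro!: bdd_above_norm_image_ball[OF hol])
  qed
  define F where "F z = f (w + z)" for z
  have F: "F holomorphic_on ball 0 4"
    unfolding F_def
  proof (rule holomorphic_on_compose_gen[of "\<lambda>z. w + z" _ f "ball 0 5", unfolded o_def])
    have "w + z \<in> ball 0 5" if "z \<in> ball 0 4" for z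
      using norm_triangle_ineq[of w z] w(1) that by simp
    then show "(\<lambda>z. w + z) ` ball 0 4 \<subseteq> ball 0 5"
      by blast
  qed (auto intro!: holomorphic_intros hol)
  have F_le: "cmod (F z) \<le> M" if "cmod z \<le> 3" for z
    unfolding F_def using norm_triangle_ineq[of w z] w(1) that by (intro le_M) linarith
  have F0: "exp (- 2 * H0) * M \<le> cmod (F 0)"
    using w(2) by (simp add: F_def)
  obtain N :: nat and a g where N: "real N \<le> 6 * H0" and a: "\<And>j. j < N \<Longrightarrow> cmod (a j) < 2"
    and g: "g holomorphic_on ball 0 4" and Fg: "\<And>z. cmod z < 4 \<Longrightarrow> F z = g z * (\<Prod>j<N. blaschke (a j) z)"
    and g_le: "\<And>z. cmod z \<le> 3 \<Longrightarrow> cmod (g z) \<le> M" and g0: "exp (- 2 * H0) * M \<le> cmod (g 0)"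
    and g_nz: "\<And>z. cmod z < 2 \<Longrightarrow> g z \<noteq> 0"
    using blaschke_factorization[OF F M F_le F0] by blast
  define c where "c j = Re (w + a j)" for j
  have lower: "M * exp (- (41 * (H0 + H1))) * h ^ d * exp (- (\<Sum>j<N. log_well h (x - c j)))
      \<le> cmod (f (of_real x))"
    if x: "x \<in> I0" and h: "0 < h" "h \<le> 1" and xc: "x \<notin> c ` {..<N}" for x h
  proof -
    define z where "z = of_real x - w"
    have nx: "cmod (of_real x) \<le> 1/2"
      using x by (auto simp: I0_def)
    then have z: "cmod z \<le> 3/2"
      unfolding z_def using norm_triangle_ineq4[of "of_real x" w] w(1) by linarith
    define D where "D j = cmod (z - a j)" for j
    have D: "\<bar>x - c j\<bar> \<le> D j" for j
      using abs_Re_le_cmod[of "z - a j"] by (simp add: D_def c_def z_def algebra_simps)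
    have D0: "D j \<ge> 0" for j
      by (simp add: D_def)
    \<comment> \<open>Moving from \<open>x\<close> to a point of the disc of radius \<open>h\<close>
      increases each distance to a zero by less than \<open>h\<close>.\<close>
    have upper: "cmod (f y) \<le> M * (\<Prod>j<N. D j + h)" if y: "y \<in> ball (of_real x) h" for y
    proof -
      define v where "v = y - w"
      have vz: "cmod (v - z) < h"
        using y by (simp add: v_def z_def dist_norm norm_minus_commute)
      then have v: "cmod v \<le> 3"
        using norm_triangle_ineq[of "v - z" z] z h by simp
      have "cmod (blaschke (a j) v) \<le> D j + h" if "j < N" for j
      proof -
        have "cmod (v - a j) \<le> D j + h"
          unfolding D_def using norm_triangle_ineq[of "v - z" "z - a j"] vz by simp
        with norm_blaschke_le[OF a[OF that] v] show ?thesis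
          by simp
      qed
      then have "(\<Prod>j<N. cmod (blaschke (a j) v)) \<le> (\<Prod>j<N. D j + h)"
        by (intro prod_mono) auto
      then have "cmod (g v) * (\<Prod>j<N. cmod (blaschke (a j) v)) \<le> M * (\<Prod>j<N. D j + h)"
        using g_le[OF v] M by (intro mult_mono prod_nonneg) auto
      then show ?thesis
        using Fg[of v] v by (simp add: F_def v_def norm_mult flip: prod_norm)
    qed
    \<comment> \<open>The disc of radius 4 around \<open>x\<close> contains \<open>w\<close>, so the
      left side of the local hypothesis is almost as large as \<open>M\<close>; its right side is
      controlled by \<open>upper\<close>.\<close>
    have "exp (- 2 * H0) * M \<le> (SUP z\<in>ball (of_real x) 4. cmod (f z))"
    proof (rule cSUP_upper2[where x = w])
      show "w \<in> ball (of_real x) 4"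
        using z by (simp add: z_def dist_norm)
      show "bdd_above ((\<lambda>z. cmod (f z)) ` ball (of_real x) 4)"
        using nx by (intro bdd_above_norm_image_ball[OF hol]) (auto simp: ball_subset_cball_iff)
    qed (use w(2) in simp)
    also have "\<dots> \<le> exp H1 * h powi (- int d) * (SUP z\<in>ball (of_real x) h. cmod (f z))"
      using loc x h by blast
    also have "\<dots> \<le> exp H1 * h powi (- int d) * (M * (\<Prod>j<N. D j + h))"
      using h upper by (intro mult_left_mono cSUP_least) auto
    finally have "M * exp (- 2 * H0) \<le> M * (exp H1 * h powi (- int d) * (\<Prod>j<N. D j + h))"
      by (simp add: mult_ac)
    then have "exp (- 2 * H0) \<le> exp H1 * h powi (- int d) * (\<Prod>j<N. D j + h)"
      using M mult_le_cancel_left_pos by blast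
    then have "exp (- 2 * H0) / exp H1 * h ^ d \<le> (\<Prod>j<N. D j + h)"
      using h by (simp add: power_int_minus field_simps)
    then have prodD: "exp (- 2 * H0 - H1) * h ^ d \<le> (\<Prod>j<N. D j + h)"
      by (simp add: exp_diff)
    \<comment> \<open>Each of the at most 6 * H0 factors loses 1/8, hence at most 3 in the
      exponent.\<close>
    have "exp (- 18 * H0) \<le> exp (- 3 * real N)"
      using N by simp
    also note exp_minus_three_power_le[of N]
    finally have "exp (- 18 * H0) * (exp (- 2 * H0 - H1) * h ^ d) \<le> (1/8) ^ N * (\<Prod>j<N. D j + h)"
      using prodD h by (intro mult_mono) auto
    also have "\<dots> = (\<Prod>j<N. (D j + h) / 8)"
      by (simp add: prod_dividef power_divide)
    finally have "exp (- 18 * H0) * (exp (- 2 * H0 - H1) * h ^ d) * exp (- (\<Sum>j<N. log_well h (x - c j)))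
      \<le> (\<Prod>j<N. (D j + h) / 8) * exp (- (\<Sum>j<N. log_well h (x - c j)))"
      by (intro mult_right_mono) auto
    also have "\<dots> = (\<Prod>j<N. (D j + h) / 8 * exp (- log_well h (x - c j)))"
      unfolding prod.distrib by (simp add: exp_sum flip: sum_negf)
    also have "\<dots> \<le> (\<Prod>j<N. cmod (blaschke (a j) z))"
    proof (intro prod_mono conjI)
      fix j assume "j \<in> {..<N}"
      then have "(D j + h) / 8 * exp (- log_well h (x - c j)) \<le> D j / 4"
        using xc h by (intro log_well_ratio D) auto
      also have "D j / 4 \<le> cmod (blaschke (a j) z)"
        unfolding D_def using \<open>j \<in> {..<N}\<close> a z by (intro norm_blaschke_ge) auto
      finally show "(D j + h) / 8 * exp (- log_well h (x - c j)) \<le> cmod (blaschke (a j) z)" .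
    qed (use D0 h in auto)
    finally have "exp (- 21 * H0) * M * (exp (- 18 * H0) * (exp (- 2 * H0 - H1) * h ^ d)
        * exp (- (\<Sum>j<N. log_well h (x - c j))))
      \<le> cmod (g z) * (\<Prod>j<N. cmod (blaschke (a j) z))"
      using nonvanishing_lower_bound[OF g M g_le g_nz g0 H0 z] h M by (intro mult_mono) auto
    also have "\<dots> = cmod (f (of_real x))"
      using Fg[of z] z by (simp add: F_def z_def norm_mult flip: prod_norm)
    finally have *: "M * (exp (- 21 * H0) * exp (- 18 * H0) * exp (- 2 * H0 - H1)) * h ^ d
        * exp (- (\<Sum>j<N. log_well h (x - c j))) \<le> cmod (f (of_real x))"
      by (simp add: mult_ac)
    \<comment> \<open>41 = 21 + 18 + 2: the zero-free quotient, the factors 1/8, and the choice of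
      \<open>w\<close>.\<close>
    have "exp (- (41 * (H0 + H1))) \<le> exp (- 21 * H0) * exp (- 18 * H0) * exp (- 2 * H0 - H1)"
      using H1 by (simp flip: exp_add)
    then have "M * exp (- (41 * (H0 + H1))) * h ^ d * exp (- (\<Sum>j<N. log_well h (x - c j)))
      \<le> M * (exp (- 21 * H0) * exp (- 18 * H0) * exp (- 2 * H0 - H1)) * h ^ d
        * exp (- (\<Sum>j<N. log_well h (x - c j)))"
      using M h by (intro mult_right_mono mult_left_mono) auto
    with * show ?thesis
      by linarith
  qed
  show thesis
    by (rule that[OF N M _ lower]) (auto simp: I0_def intro!: le_M)
qed

section \<open>Consequences of the pointwise lower bound\<close>

lemma I0_lmeasurable: "I0 \<in> lmeasurable" "measure lebesgue I0 = 1"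
  by (auto simp: I0_def)

lemma is_interval_convex_sublevel:
  fixes u :: "real \<Rightarrow> real"
  assumes u: "convex_on J u"
  shows "is_interval {x \<in> J. u x \<le> T}"
  unfolding is_interval_convex_1 convex_alt
proof (intro ballI allI impI)
  fix x y t :: real
  assume x: "x \<in> {x \<in> J. u x \<le> T}" and y: "y \<in> {x \<in> J. u x \<le> T}" and t: "0 \<le> t \<and> t \<le> 1"
  have "u ((1 - t) *\<^sub>R x + t *\<^sub>R y) \<le> (1 - t) * u x + t * u y"
    using convex_onD[OF u] x y t by blast
  also have "\<dots> \<le> T"
    using x y t by (intro convex_bound_le) auto
  finally show "(1 - t) *\<^sub>R x + t *\<^sub>R y \<in> {x \<in> J. u x \<le> T}"
    using convexD_alt[OF convex_on_imp_convex[OF u]] x y t by simp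
qed

text \<open>Here \<open>p\<close> stands for |f| on \<open>I0\<close>, with K = 41 * (H0 + H1) and T
  = 6 * H0 in the application. What follows is real analysis only.\<close>

locale log_well_bound =
  fixes p :: "real \<Rightarrow> real" and c :: "nat \<Rightarrow> real" and N d :: nat and M K T :: real
  assumes cont: "continuous_on I0 p"
    and upper: "\<And>x. x \<in> I0 \<Longrightarrow> p x \<le> M" and M_pos: "M > 0"
    and lower: "\<And>x h. x \<in> I0 \<Longrightarrow> 0 < h \<Longrightarrow> h \<le> 1 \<Longrightarrow> x \<notin> c ` {..<N} \<Longrightarrow>
      M * exp (- K) * h ^ d * exp (- (\<Sum>j<N. log_well h (x - c j))) \<le> p x"
    and N_le: "real N \<le> T" and T_pos: "T > 0" and d_pos: "d \<ge> 1"
begin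

lemma pos: "x \<in> I0 \<Longrightarrow> x \<notin> c ` {..<N} \<Longrightarrow> p x > 0"
  using lower[of x 1] M_pos by (smt (verit) exp_gt_zero mult_pos_pos power_one zero_less_one)

lemma finite_zeros: "finite {x \<in> I0. p x = 0}"
  by (rule finite_subset[of _ "c ` {..<N}"]) (use pos in force)+

lemma ln_lower:
  assumes "x \<in> I0" "0 < h" "h \<le> 1" "x \<notin> c ` {..<N}"
  shows "ln M - K + d * ln h - (\<Sum>j<N. log_well h (x - c j)) \<le> ln (p x)"
proof -
  have "ln (M * exp (- K) * h ^ d * exp (- (\<Sum>j<N. log_well h (x - c j)))) \<le> ln (p x)"
    using assms lower[OF assms] pos M_pos by simp
  then show ?thesis
    using M_pos assms by (simp add: ln_mult ln_realpow)
qed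

context
  fixes E :: "real set"
  assumes E: "E \<in> sets lebesgue" "E \<subseteq> I0"
begin

lemma E_lmeasurable: "E \<in> lmeasurable"
  using E I0_lmeasurable fmeasurableI2 by blast

lemma finite_measure_E: "finite_measure (lebesgue_on E)"
  using E_lmeasurable finite_measure_lebesgue_on by blast

lemma AE_E:
  assumes "\<And>x. x \<in> I0 \<Longrightarrow> x \<notin> c ` {..<N} \<Longrightarrow> P x"
  shows "AE x in lebesgue_on E. P x"
proof -
  have "c ` {..<N} \<in> null_sets lebesgue"
    by (simp add: negligible_finite flip: negligible_iff_null_sets)
  then have "AE x in lebesgue. x \<notin> c ` {..<N}"
    by (rule AE_not_in)
  then show ?thesis
    using E assms by (auto simp: AE_restrict_space_iff elim!: eventually_mono)
qed

lemma p_measurable: "p \<in> borel_measurable (lebesgue_on E)"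
proof -
  have "continuous_on E p"
    using cont E(2) continuous_on_subset by blast
  then show ?thesis
    using E(1) continuous_imp_measurable_on_sets_lebesgue by blast
qed

lemma wells_integrable:
  assumes "h > 0"
  shows "integrable (lebesgue_on E) (\<lambda>x. \<Sum>j<N. log_well h (x - c j))"
    and "(LINT x|lebesgue_on E. (\<Sum>j<N. log_well h (x - c j))) \<le> 2 * h * N"
proof -
  let ?u = "\<lambda>x. \<Sum>j<N. log_well h (x - c j)"
  note u = sum_log_well_integrable[OF assms, where c = c and N = N]
  show "integrable (lebesgue_on E) ?u"
    using integrable_mult_indicator[OF E(1) u(1)] E(1) by (simp add: integrable_restrict_space)
  have "(LINT x|lebesgue_on E. ?u x) = (LINT x|lebesgue. indicator E x *\<^sub>R ?u x)"
    using E(1) by (simp add: integral_restrict_space)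
  also have "\<dots> \<le> (LINT x|lebesgue. ?u x)"
    using E(1) u(1) by (intro integral_mono integrable_mult_indicator)
      (auto simp: indicator_def intro!: sum_nonneg log_well_nonneg)
  finally show "(LINT x|lebesgue_on E. ?u x) \<le> 2 * h * N"
    using u(2) by simp
qed

lemma ln_integrable: "integrable (lebesgue_on E) (\<lambda>x. ln (p x))"
proof (rule Bochner_Integration.integrable_bound)
  interpret finite_measure "lebesgue_on E"
    by (rule finite_measure_E)
  \<comment> \<open>The dominating function is the case h = 1 of \<open>ln_lower\<close>, where the
    term d * ln h vanishes.\<close>
  show "integrable (lebesgue_on E) (\<lambda>x. \<bar>ln M\<bar> + \<bar>K\<bar> + (\<Sum>j<N. log_well 1 (x - c j)))"
    by (intro Bochner_Integration.integrable_add wells_integrable) auto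
  show "(\<lambda>x. ln (p x)) \<in> borel_measurable (lebesgue_on E)"
    using p_measurable by measurable
  show "AE x in lebesgue_on E. norm (ln (p x)) \<le> norm (\<bar>ln M\<bar> + \<bar>K\<bar> + (\<Sum>j<N. log_well 1 (x - c j)))"
  proof (rule AE_E)
    fix x assume x: "x \<in> I0" "x \<notin> c ` {..<N}"
    have "ln (p x) \<le> ln M"
      using upper[OF x(1)] pos[OF x] M_pos by simp
    moreover have "(\<Sum>j<N. log_well 1 (x - c j)) \<ge> 0"
      by (intro sum_nonneg log_well_nonneg)
    ultimately show "norm (ln (p x)) \<le> norm (\<bar>ln M\<bar> + \<bar>K\<bar> + (\<Sum>j<N. log_well 1 (x - c j)))"
      using ln_lower[OF x(1) _ _ x(2), of 1] by simp
  qed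
qed

context
  assumes E_pos: "measure lebesgue E > 0"
begin

lemma E_le_1: "measure lebesgue E \<le> 1"
  using measure_mono_fmeasurable[OF E(2) E(1) I0_lmeasurable(1)] I0_lmeasurable(2) by simp

lemma measure_E: "measure (lebesgue_on E) (space (lebesgue_on E)) = measure lebesgue E"
  using E(1) by (simp add: measure_restrict_space)

text \<open>Averaging \<open>ln_lower\<close> over \<open>E\<close> with h = |E|: the wells
  integrate to at most 2 * h * N, so division by |E| leaves 2 * N, and the term d * ln h becomes the
  power of |E|.\<close>

lemma mean_lower:
  "M * exp (- K - 2 * N) * measure lebesgue E ^ d
    \<le> exp (1 / measure lebesgue E * (LINT x|lebesgue_on E. ln (p x)))"
proof -
  interpret finite_measure "lebesgue_on E"
    by (rule finite_measure_E)
  define \<alpha> where "\<alpha> = measure lebesgue E"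
  have \<alpha>: "0 < \<alpha>" "\<alpha> \<le> 1"
    using E_pos E_le_1 by (auto simp: \<alpha>_def)
  let ?u = "\<lambda>x. \<Sum>j<N. log_well \<alpha> (x - c j)"
  have "\<alpha> * (ln M - K + d * ln \<alpha> - 2 * N) \<le> \<alpha> * (ln M - K + d * ln \<alpha>) - (LINT x|lebesgue_on E. ?u x)"
    using wells_integrable(2)[OF \<alpha>(1)] by (simp add: algebra_simps)
  also have "\<dots> = (LINT x|lebesgue_on E. (ln M - K + d * ln \<alpha> - ?u x))"
    using measure_E wells_integrable(1)[OF \<alpha>(1)]
    by (subst Bochner_Integration.integral_diff) (auto simp: \<alpha>_def)
  also have "\<dots> \<le> (LINT x|lebesgue_on E. ln (p x))"
    using wells_integrable(1)[OF \<alpha>(1)] ln_lower \<alpha>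
    by (intro integral_mono_AE ln_integrable AE_E) auto
  finally have "ln M - K + d * ln \<alpha> - 2 * N \<le> 1 / \<alpha> * (LINT x|lebesgue_on E. ln (p x))"
    using \<alpha>(1) by (simp add: field_simps)
  then have "exp (ln M + (- K - 2 * N) + d * ln \<alpha>) \<le> exp (1 / \<alpha> * (LINT x|lebesgue_on E. ln (p x)))"
    by simp
  moreover have "exp (ln M + (- K - 2 * N) + d * ln \<alpha>) = M * exp (- K - 2 * N) * \<alpha> ^ d"
    unfolding exp_add using M_pos \<alpha>(1) by (simp add: exp_of_nat_mult)
  ultimately show ?thesis
    unfolding \<alpha>_def by metis
qed

text \<open>Positivity of \<open>e\<close> is derived: \<open>p\<close> is positive almost
  everywhere and \<open>E\<close> is not a null set.\<close>

lemma mean_le: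
  assumes "AE x in lebesgue_on E. p x \<le> e"
  shows "exp (1 / measure lebesgue E * (LINT x|lebesgue_on E. ln (p x))) \<le> e"
proof -
  interpret finite_measure "lebesgue_on E"
    by (rule finite_measure_E)
  have AE: "AE x in lebesgue_on E. 0 < p x \<and> p x \<le> e"
    using AE_E[OF pos] assms by auto
  have "e > 0"
  proof (rule ccontr)
    assume "\<not> e > 0"
    then have "AE x in lebesgue_on E. False"
      using AE by (auto elim: eventually_mono[rotated])
    then have "emeasure (lebesgue_on E) (space (lebesgue_on E)) = 0"
      unfolding ae_filter_eq_bot_iff[symmetric] trivial_limit_def .
    then have "measure lebesgue E = 0"
      using measure_E by (simp add: measure_def)
    with E_pos show False
      by simp
  qed
  have "AE x in lebesgue_on E. ln (p x) \<le> ln e"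
    using AE by (rule eventually_mono) (use \<open>e > 0\<close> in auto)
  then have "(LINT x|lebesgue_on E. ln (p x)) \<le> (LINT x|lebesgue_on E. ln e)"
    by (intro integral_mono_AE ln_integrable) auto
  also have "\<dots> = measure lebesgue E * ln e"
    using measure_E by simp
  finally have "1 / measure lebesgue E * (LINT x|lebesgue_on E. ln (p x)) \<le> ln e"
    using E_pos by (simp add: field_simps)
  then have "exp (1 / measure lebesgue E * (LINT x|lebesgue_on E. ln (p x))) \<le> exp (ln e)"
    by simp
  then show ?thesis
    using \<open>e > 0\<close> by simp
qed

end
end

lemma exceptional_set:
  assumes h: "0 < h" "h \<le> 1"
  obtains \<Omega> \<J> where "\<Omega> \<subseteq> I0" "\<Omega> = \<Union>\<J>" "finite \<J>" "card \<J> \<le> 9 * N + 2" "\<forall>J\<in>\<J>. is_interval J"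
    "\<Omega> \<in> lmeasurable" "measure lebesgue \<Omega> \<le> 2 * h"
    "\<And>x. x \<in> I0 - \<Omega> \<Longrightarrow> M * exp (- K - T) * h ^ d \<le> p x"
proof -
  let ?u = "\<lambda>x. \<Sum>j<N. log_well h (x - c j)"
  define B where "B = c ` {..<N} \<union> (\<lambda>j. c j - h) ` {..<N} \<union> (\<lambda>j. c j + h) ` {..<N}"
  \<comment> \<open>The null set \<open>B\<close> is included so that on an interval avoiding
    \<open>B\<close> the complement is a sublevel set of a convex function, and so that outside the
    set the centres are excluded. With at most 3 * N break points the count is 3 * (3 * N) +
    2.\<close>
  define \<Omega> where "\<Omega> = {x \<in> I0. x \<in> B \<or> T < ?u x}"
  have B: "finite B" "card B \<le> 3 * N"
  proof -
    have "card B \<le> card (c ` {..<N}) + card ((\<lambda>j. c j - h) ` {..<N}) + card ((\<lambda>j. c j + h) ` {..<N})"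
      unfolding B_def by (intro card_Un_le[THEN order_trans] add_mono) auto
    also have "\<dots> \<le> N + N + N"
      by (intro add_mono) (metis card_image_le finite_lessThan card_lessThan)+
    finally show "card B \<le> 3 * N" by simp
  qed (simp add: B_def)
  have iv: "is_interval (J - \<Omega>)" if J: "is_interval J" "J \<subseteq> I0" "J \<inter> B = {}" for J
  proof -
    have *: "c j \<notin> J \<and> c j - h \<notin> J \<and> c j + h \<notin> J" if "j < N" for j
      using that J(3) unfolding B_def by blast
    have cvx: "convex_on J ?u"
      using * by (intro convex_on_sum_log_well J h)
    have "J - \<Omega> = {x \<in> J. ?u x \<le> T}"
      using J by (auto simp: \<Omega>_def)
    moreover have "is_interval {x \<in> J. ?u x \<le> T}"
      by (rule is_interval_convex_sublevel[OF cvx])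
    ultimately show ?thesis
      by simp
  qed
  have "is_interval I0"
    by (simp add: I0_def)
  moreover have "\<Omega> \<subseteq> I0"
    by (auto simp: \<Omega>_def)
  ultimately obtain \<J> where \<J>: "\<Omega> = \<Union>\<J>" "finite \<J>" "card \<J> \<le> 3 * card B + 2" "\<forall>J\<in>\<J>. is_interval J"
    using union_of_few_intervals[OF B(1) _ _ iv] by blast
  have sup: "{x. T < ?u x} \<in> lmeasurable" "measure lebesgue {x. T < ?u x} \<le> 2 * h"
    using sum_log_well_superlevel_measure[OF h(1) N_le T_pos] by auto
  have B0: "B \<in> null_sets lebesgue"
    using B(1) by (simp add: negligible_finite flip: negligible_iff_null_sets)
  have \<Omega>_eq: "\<Omega> = I0 \<inter> (B \<union> {x. T < ?u x})"
    by (auto simp: \<Omega>_def)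
  have Bl: "B \<in> lmeasurable"
    using B0 by (rule fmeasurableI_null_sets)
  have \<Omega>_meas: "\<Omega> \<in> lmeasurable"
    unfolding \<Omega>_eq using I0_lmeasurable(1) Bl sup(1) by (intro fmeasurable.Int fmeasurable.Un)
  have "measure lebesgue \<Omega> \<le> measure lebesgue (B \<union> {x. T < ?u x})"
    unfolding \<Omega>_eq using I0_lmeasurable(1) Bl sup(1)
    by (intro measure_mono_fmeasurable fmeasurable.Un fmeasurableD fmeasurable.Int) auto
  also have "\<dots> = measure lebesgue {x. T < ?u x}"
    using measure_Un_null_set[OF fmeasurableD[OF sup(1)] B0] by (simp add: Un_commute)
  finally have \<Omega>_le: "measure lebesgue \<Omega> \<le> 2 * h"
    using sup(2) by linarith
  have low: "M * exp (- K - T) * h ^ d \<le> p x" if "x \<in> I0 - \<Omega>" for x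
  proof -
    have x: "x \<in> I0" "x \<notin> c ` {..<N}" "?u x \<le> T"
      using that by (auto simp: \<Omega>_def B_def)
    have "M * exp (- K) * h ^ d * exp (- T) \<le> M * exp (- K) * h ^ d * exp (- ?u x)"
      using x M_pos h by (intro mult_left_mono) auto
    also have "\<dots> \<le> p x"
      using lower[OF x(1) h x(2)] .
    finally show ?thesis
      by (simp add: exp_diff exp_minus field_simps)
  qed
  show thesis
    by (rule that[OF \<open>\<Omega> \<subseteq> I0\<close> \<J>(1,2) _ \<J>(4) \<Omega>_meas \<Omega>_le low]) (use \<J>(3) B(2) in auto)
qed

lemma sublevel_measure:
  assumes \<epsilon>: "0 < \<epsilon>" and S: "S \<le> M"
  shows "measure lebesgue {x \<in> I0. p x \<le> \<epsilon> * S} \<le> 4 * exp ((K + T) / d) * \<epsilon> powr (1 / d)"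
proof -
  let ?A = "{x \<in> I0. p x \<le> \<epsilon> * S}"
  \<comment> \<open>With this \<open>h\<close> the lower bound off the exceptional set equals 2 *
    \<epsilon> * M, which exceeds \<epsilon> * S, so the sublevel set lies inside the exceptional
    set.\<close>
  define h where "h = (2 * \<epsilon> * exp (K + T)) powr (1 / d)"
  have h: "h > 0" "h ^ d = 2 * \<epsilon> * exp (K + T)"
    using \<epsilon> d_pos by (simp_all add: h_def powr_powr flip: powr_realpow)
  have "closed ?A"
    using continuous_closed_preimage[OF cont _ closed_atMost[of "\<epsilon> * S"]]
    by (simp add: I0_def vimage_def Int_def conj_commute)
  then have A: "?A \<in> sets lebesgue"
    by (simp add: borel_closed sets_completionI_sets)
  have A_le: "measure lebesgue ?A \<le> 2 * h"
  proof (cases "h \<le> 1")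
    case True
    obtain \<Omega> where \<Omega>: "\<Omega> \<in> lmeasurable" "measure lebesgue \<Omega> \<le> 2 * h"
      "\<And>x. x \<in> I0 - \<Omega> \<Longrightarrow> M * exp (- K - T) * h ^ d \<le> p x"
      using exceptional_set[OF h(1) True] by metis
    have "M * exp (- K - T) * h ^ d = 2 * \<epsilon> * M"
      unfolding h(2) by (simp add: exp_add exp_diff exp_minus field_simps)
    moreover have "\<epsilon> * S < 2 * \<epsilon> * M"
      using S \<epsilon> M_pos mult_left_mono[OF S, of \<epsilon>] mult_pos_pos[OF \<epsilon> M_pos] by linarith
    ultimately have "\<epsilon> * S < p x" if "x \<in> I0 - \<Omega>" for x
      using \<Omega>(3)[OF that] by linarith
    then have "?A \<subseteq> \<Omega>"
      by force
    then show ?thesis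
      using measure_mono_fmeasurable[OF _ A \<Omega>(1)] \<Omega>(2) by fastforce
  next
    case False
    \<comment> \<open>For h > 1 the claim is trivial, since \<open>I0\<close> has measure 1.\<close>
    have "measure lebesgue ?A \<le> measure lebesgue I0"
      by (intro measure_mono_fmeasurable A I0_lmeasurable) auto
    then show ?thesis
      using False I0_lmeasurable(2) by simp
  qed
  have "h = 2 powr (1 / d) * \<epsilon> powr (1 / d) * exp ((K + T) / d)"
    using \<epsilon> by (simp add: h_def powr_mult exp_powr_real)
  moreover have "2 powr (1 / d) \<le> 2 powr (1::real)"
    using d_pos by (intro powr_mono) auto
  ultimately have "h \<le> 2 * \<epsilon> powr (1 / d) * exp ((K + T) / d)"
    by (simp add: mult_right_mono)
  with A_le show ?thesis
    by (simp add: mult_ac)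
qed

end

theorem theorem1p1:
  shows "\<exists>C::real. C > 0 \<and>
    (\<forall>(f :: complex \<Rightarrow> complex) (d :: nat) (H0 :: real) (H1 :: real).
      f holomorphic_on ball 0 5 \<longrightarrow>
      (\<exists>z\<in>ball 0 5. f z \<noteq> 0) \<longrightarrow>
      d \<ge> 1 \<longrightarrow> H0 \<ge> 1 \<longrightarrow> H1 \<ge> real d \<longrightarrow>
      (SUP z\<in>ball 0 4. cmod (f z)) \<le> exp H0 * (SUP z\<in>ball 0 1. cmod (f z)) \<longrightarrow>
      (\<forall>x\<in>I0. \<forall>r::real. 0 < r \<and> r \<le> 1 \<longrightarrow>
         (SUP z\<in>ball (of_real x) 4. cmod (f z))
           \<le> exp H1 * r powi (- int d) * (SUP z\<in>ball (of_real x) r. cmod (f z))) \<longrightarrow>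
      \<comment> \<open>(i)\<close>
      (finite {x\<in>I0. f (of_real x) = 0} \<and>
       integrable (lebesgue_on I0) (\<lambda>x. ln (cmod (f (of_real x)))) \<and>
       (\<forall>E. E \<in> sets lebesgue \<and> E \<subseteq> I0 \<and> measure lebesgue E > 0 \<longrightarrow>
          integrable (lebesgue_on E) (\<lambda>x. ln (cmod (f (of_real x)))))) \<and>
      \<comment> \<open>(ii)\<close>
      (\<forall>E \<alpha>. E \<in> sets lebesgue \<and> E \<subseteq> I0 \<and> measure lebesgue E = \<alpha> \<and> \<alpha> > 0 \<longrightarrow>
         (SUP x\<in>I0. cmod (f (of_real x)))
           \<le> exp (C * (H0 + H1)) * (C / \<alpha>) ^ d * geom_mean E (\<lambda>x. f (of_real x)) \<and>
         ereal (SUP x\<in>I0. cmod (f (of_real x)))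
           \<le> ereal (exp (C * (H0 + H1)) * (C / \<alpha>) ^ d)
               * esssup (lebesgue_on E) (\<lambda>x. ereal (cmod (f (of_real x))))) \<and>
      \<comment> \<open>(iii)\<close>
      (\<forall>h::real. 0 < h \<and> h \<le> 1 \<longrightarrow>
         (\<exists>\<Omega> \<J>. \<Omega> \<subseteq> I0 \<and> \<Omega> = \<Union>\<J> \<and>
            finite \<J> \<and> int (card \<J>) \<le> \<lceil>C * H0\<rceil> \<and> (\<forall>J\<in>\<J>. is_interval J) \<and>
            measure lebesgue \<Omega> \<le> C * h \<and>
            (\<forall>x\<in>I0 - \<Omega>. cmod (f (of_real x))
               \<ge> exp (- C * (H0 + H1)) * h ^ d * (SUP y\<in>I0. cmod (f (of_real y)))))) \<and>
      \<comment> \<open>(iv)\<close>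
      (\<forall>\<epsilon>::real. 0 < \<epsilon> \<and> \<epsilon> \<le> 1 \<longrightarrow>
         measure lebesgue {x\<in>I0. cmod (f (of_real x)) \<le> \<epsilon> * (SUP y\<in>I0. cmod (f (of_real y)))}
           \<le> C * exp (C * ((H0 + H1) / real d)) * \<epsilon> powr (1 / real d)))"
  \<comment> \<open>The value 60 dominates every constant that occurs: 41 + 2 * 6 = 53 in the mean
    bound, 9 * 6 + 2 = 56 in the interval count, 41 + 6 = 47 in the exceptional and sublevel
    bounds.\<close>
  apply (rule exI[of _ 60], rule conjI, simp)
  apply (intro allI)
  apply (rule impI)+
  subgoal premises prems for f d H0 H1
  proof -
    note hol = prems(1) and nz = prems(2) and d = prems(3) and H0 = prems(4) and H1 = prems(5)
      and glob = prems(6) and loc = prems(7)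
    have H1_nonneg: "H1 \<ge> 0"
      using H1 by (rule order_trans[rotated]) simp
    define p where "p x = cmod (f (of_real x))" for x :: real
    obtain N :: nat and c M where N: "real N \<le> 6 * H0" and M: "M > 0"
      and upper: "\<And>x. x \<in> I0 \<Longrightarrow> p x \<le> M"
      and lower: "\<And>x h. x \<in> I0 \<Longrightarrow> 0 < h \<Longrightarrow> h \<le> 1 \<Longrightarrow> x \<notin> c ` {..<N} \<Longrightarrow>
        M * exp (- (41 * (H0 + H1))) * h ^ d * exp (- (\<Sum>j<N. log_well h (x - c j))) \<le> p x"
      by (rule log_well_lower_bound[OF hol nz H0 H1_nonneg glob loc, folded p_def]) (rule that)
    have "continuous_on I0 p"
      unfolding p_def
      by (intro continuous_intros continuous_on_compose2[OF holomorphic_on_imp_continuous_on[OF hol]])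
        (auto simp: I0_def)
    then interpret log_well_bound p c N d M "41 * (H0 + H1)" "6 * H0"
      by unfold_locales (use upper M lower N H0 d in \<open>auto simp: p_def\<close>)
    define S where "S = (SUP x\<in>I0. p x)"
    have S_le: "S \<le> M"
      unfolding S_def using upper by (intro cSUP_least) (auto simp: I0_def)
    have geom: "geom_mean E (\<lambda>x. f (of_real x))
        = exp (1 / measure lebesgue E * (LINT x|lebesgue_on E. ln (p x)))" for E
      by (simp add: geom_mean_def p_def)
    have mean: "S \<le> exp (60 * (H0 + H1)) * (60 / measure lebesgue E) ^ d * geom_mean E (\<lambda>x. f (of_real x))"
      if E: "E \<in> sets lebesgue" "E \<subseteq> I0" "measure lebesgue E > 0" for E
    proof -
      define \<alpha> where "\<alpha> = measure lebesgue E"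
      have \<alpha>: "\<alpha> > 0"
        using E(3) by (simp add: \<alpha>_def)
      define k where "k = - (41 * (H0 + H1)) - 2 * real N"
      have k: "- (60 * (H0 + H1)) \<le> k"
        using N H1_nonneg H0 by (simp add: k_def)
      have "M * exp k * \<alpha> ^ d \<le> geom_mean E (\<lambda>x. f (of_real x))"
        using mean_lower[OF E] by (simp add: geom \<alpha>_def k_def)
      then have "M \<le> exp (- k) * (1 / \<alpha>) ^ d * geom_mean E (\<lambda>x. f (of_real x))"
        using \<alpha> by (simp add: exp_minus field_simps)
      also have "\<dots> \<le> exp (60 * (H0 + H1)) * (60 / \<alpha>) ^ d * geom_mean E (\<lambda>x. f (of_real x))"
        using k \<alpha> by (intro mult_right_mono mult_mono power_mono divide_right_mono) (auto simp: geom)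
      finally show ?thesis
        using S_le by (simp add: \<alpha>_def)
    qed
    have mean': "ereal S \<le> ereal (exp (60 * (H0 + H1)) * (60 / measure lebesgue E) ^ d)
        * esssup (lebesgue_on E) (\<lambda>x. ereal (p x))"
      if E: "E \<in> sets lebesgue" "E \<subseteq> I0" "measure lebesgue E > 0" for E
    proof -
      define A where "A = exp (60 * (H0 + H1)) * (60 / measure lebesgue E) ^ d"
      have A: "A > 0"
        using E(3) by (simp add: A_def)
      have AE: "AE x in lebesgue_on E. ereal (p x) \<le> esssup (lebesgue_on E) (\<lambda>x. ereal (p x))"
        by (rule esssup_AE)
      show ?thesis
        unfolding A_def[symmetric]
      proof (cases "esssup (lebesgue_on E) (\<lambda>x. ereal (p x))")
        case (real e)
        then have "AE x in lebesgue_on E. p x \<le> e"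
          using AE by simp
        from mean_le[OF E this] have "S \<le> A * e"
          using mean[OF E] A mult_left_mono[of _ e A] unfolding geom A_def[symmetric]
          by (meson less_imp_le order_trans)
        then show "ereal S \<le> ereal A * esssup (lebesgue_on E) (\<lambda>x. ereal (p x))"
          by (simp add: real)
      next
        case PInf
        then show "ereal S \<le> ereal A * esssup (lebesgue_on E) (\<lambda>x. ereal (p x))"
          using A by simp
      next
        case MInf
        \<comment> \<open>This case is contradictory: \<open>mean_le\<close> with e = 0 would make
          an exponential nonpositive.\<close>
        then have "AE x in lebesgue_on E. False"
          using AE by simp
        then have "AE x in lebesgue_on E. p x \<le> 0"
          by (rule eventually_mono) simp
        with mean_le[OF E this] not_exp_le_zero show "ereal S \<le> ereal A * esssup (lebesgue_on E) (\<lambda>x. ereal (p x))"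
          by blast
      qed
    qed
    have except: "\<exists>\<Omega> \<J>. \<Omega> \<subseteq> I0 \<and> \<Omega> = \<Union>\<J> \<and> finite \<J> \<and> int (card \<J>) \<le> \<lceil>60 * H0\<rceil> \<and>
        (\<forall>J\<in>\<J>. is_interval J) \<and> measure lebesgue \<Omega> \<le> 60 * h \<and>
        (\<forall>x\<in>I0 - \<Omega>. exp (- 60 * (H0 + H1)) * h ^ d * S \<le> p x)"
      if h: "0 < h" "h \<le> 1" for h
    proof -
      obtain \<Omega> \<J> where \<Omega>: "\<Omega> \<subseteq> I0" "\<Omega> = \<Union>\<J>" "finite \<J>" "card \<J> \<le> 9 * N + 2"
        "\<forall>J\<in>\<J>. is_interval J" "measure lebesgue \<Omega> \<le> 2 * h"
        and low: "\<And>x. x \<in> I0 - \<Omega> \<Longrightarrow> M * exp (- (41 * (H0 + H1)) - 6 * H0) * h ^ d \<le> p x"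
        using exceptional_set[OF h] by metis
      have "real (card \<J>) \<le> real (9 * N + 2)"
        using \<Omega>(4) by (rule of_nat_mono)
      also have "\<dots> \<le> 60 * H0"
        using N H0 by simp
      finally have "int (card \<J>) \<le> \<lceil>60 * H0\<rceil>"
        by linarith
      moreover have "exp (- 60 * (H0 + H1)) * h ^ d * S \<le> p x" if "x \<in> I0 - \<Omega>" for x
      proof -
        have "exp (- 60 * (H0 + H1)) * h ^ d * S \<le> exp (- 60 * (H0 + H1)) * h ^ d * M"
          using S_le h by (intro mult_left_mono) auto
        also have "\<dots> \<le> exp (- (41 * (H0 + H1)) - 6 * H0) * h ^ d * M"
          using M h H0 H1_nonneg by (intro mult_right_mono) auto
        also have "\<dots> \<le> p x"
          using low[OF that] by (simp add: mult_ac)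
        finally show ?thesis .
      qed
      ultimately show ?thesis
        using \<Omega> h by (intro exI[of _ \<Omega>] exI[of _ \<J>] conjI) auto
    qed
    have sublevel: "measure lebesgue {x\<in>I0. p x \<le> \<epsilon> * S}
        \<le> 60 * exp (60 * ((H0 + H1) / real d)) * \<epsilon> powr (1 / real d)" if "0 < \<epsilon>" for \<epsilon>
    proof -
      have "(41 * (H0 + H1) + 6 * H0) / real d \<le> 60 * (H0 + H1) / real d"
        using H0 H1_nonneg by (intro divide_right_mono) auto
      then have "4 * exp ((41 * (H0 + H1) + 6 * H0) / real d) * \<epsilon> powr (1 / real d)
          \<le> 60 * exp (60 * ((H0 + H1) / real d)) * \<epsilon> powr (1 / real d)"
        by (intro mult_right_mono mult_mono) auto
      with sublevel_measure[OF that S_le] show ?thesis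
        by linarith
    qed
    have "I0 \<in> sets lebesgue"
      using I0_lmeasurable(1) by (rule fmeasurableD)
    then show ?thesis
      using finite_zeros ln_integrable mean mean' except sublevel
      unfolding S_def p_def by (intro conjI allI impI) auto
  qed
  done

end
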